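(* Let $\mathcal A=\langle Q,\Sigma,\Delta,\mathcal R\rangle$ be a tagged TA whose language consists of tagged $n$-qubit trees, and let $v\in\{\omega,\frac1{\sqrt2}\}$. Let $\mathsf{Mult}(\mathcal A,v)$ be the TA obtained from $\mathcal A$ by replacing every leaf transition $q\xrightarrow{(a,b,c,d,k)}()$ by $q\xrightarrow{(-d,a,b,c,k)}()$ if $v=\omega$, and by $q\xrightarrow{(a,b,c,d,k+1)}()$ if $v=\frac1{\sqrt2}$ (internal transitions, states and root states unchanged). Then $\mathsf{Mult}(\mathcal A,v)\simeq_{\mathrm{Tag}}\mathcal A$ and $\mathcal L(\mathsf{Mult}(\mathcal A,v))=\{v\cdot T\mid T\in\mathcal L(\mathcal A)\}$.
   Context: Tree automata: a TA is $\mathcal A=\langle Q,\Sigma,\Delta,\mathcal R\rangle$ with finite state set $Q$, ranked alphabet $\Sigma$ of binary and constant symbols, root states $\mathcal R\subseteq Q$, and transitions that are internal $q\xrightarrow{f}(q_0,q_1)$ or leaf $q\xrightarrow{c}()$. It is assumed no state has leaf transitions with two different constants. A run on a binary tree labels each node with a state so that each leaf labelled $c$ with state $q$ has $q\xrightarrow{c}()\in\Delta$ and each internal node labelled $f$ with state $q$ and children states $q_0$ (left), $q_1$ (right) has $q\xrightarrow{f}(q_0,q_1)\in\Delta$; accepting if the root state is in $\mathcal R$; $\mathcal L(\mathcal A)$ is the set of trees with an accepting run. Leaf symbols are tuples $(a,b,c,d,k)\in\mathbb Z^5$ representing $(1/\sqrt2)^k(a+b\omega+c\omega^2+d\omega^3)$,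 $\omega=e^{i\pi/4}$. A tagged TA has binary symbols $x_k^j$ with distinct internal transitions carrying distinct symbols. A tagged $n$-qubit tree is a full binary tree of height $n$ whose internal nodes at depth $k-1$ are labelled by symbols $x_k^j$ and whose leaves are labelled in $\mathbb Z^5$. $v\cdot T$ is the tree with the same internal labels as $T$ whose every leaf label is replaced by the tuple $(-d,a,b,c,k)$ (if $v=\omega$) or $(a,b,c,d,k+1)$ (if $v=\frac1{\sqrt2}$), where $(a,b,c,d,k)$ is the original label (these represent the products with $v$). $\mathrm{Tag}(T)$ replaces every leaf label by a special symbol $\square$. $\mathcal B\simeq_{\mathrm{Tag}}\mathcal A$ means there is a bijection $S:\mathcal L(\mathcal A)\to\mathcal L(\mathcal B)$ with $\mathrm{Tag}(S(T))=\mathrm{Tag}(T)$ for all $T$. *)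

theory Defs
  imports Complex_Main
begin

datatype ('f, 'c) tree = Leaf 'c | Node 'f "('f, 'c) tree" "('f, 'c) tree"

datatype ('q, 'f, 'c) transition =
    IntTr 'q 'f 'q 'q  \<comment> \<open>\<^term>\<open>IntTr q f q0 q1\<close> is the internal transition from q via f to (q0, q1)\<close>
  | LeafTr 'q 'c       \<comment> \<open>\<^term>\<open>LeafTr q c\<close> is the leaf transition from q via c to ()\<close>

text \<open>The ranked alphabet is split by rank into binary and constant symbols.\<close>

record ('q, 'f, 'c) ta =
  states :: "'q set"
  binaries :: "'f set"
  constants :: "'c set"
  transitions :: "('q, 'f, 'c) transition set"
  roots :: "'q set"

fun transition_over :: "'q set \<Rightarrow> 'f set \<Rightarrow> 'c set \<Rightarrow> ('q, 'f, 'c) transition \<Rightarrow> bool" where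
  "transition_over Q F C (IntTr q f q0 q1) \<longleftrightarrow> q \<in> Q \<and> f \<in> F \<and> q0 \<in> Q \<and> q1 \<in> Q"
| "transition_over Q F C (LeafTr q c) \<longleftrightarrow> q \<in> Q \<and> c \<in> C"

definition tree_automaton :: "('q, 'f, 'c) ta \<Rightarrow> bool" where
  "tree_automaton A \<longleftrightarrow>
     finite (states A) \<and>
     roots A \<subseteq> states A \<and>
     (\<forall>t \<in> transitions A. transition_over (states A) (binaries A) (constants A) t) \<and>
     (\<forall>q c c'. LeafTr q c \<in> transitions A \<and> LeafTr q c' \<in> transitions A \<longrightarrow> c = c')"

text \<open>A run is a tree of the same shape all of whose labels are states.\<close>

fun root_label :: "('a, 'a) tree \<Rightarrow> 'a" where
  "root_label (Leaf q) = q"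
| "root_label (Node q l r) = q"

fun is_run :: "('q, 'f, 'c) ta \<Rightarrow> ('f, 'c) tree \<Rightarrow> ('q, 'q) tree \<Rightarrow> bool" where
  "is_run A (Leaf c) (Leaf q) \<longleftrightarrow> LeafTr q c \<in> transitions A"
| "is_run A (Node f l r) (Node q \<rho>l \<rho>r) \<longleftrightarrow>
     IntTr q f (root_label \<rho>l) (root_label \<rho>r) \<in> transitions A \<and> is_run A l \<rho>l \<and> is_run A r \<rho>r"
| "is_run A _ _ \<longleftrightarrow> False"

definition language :: "('q, 'f, 'c) ta \<Rightarrow> ('f, 'c) tree set" where
  "language A = {T. \<exists>\<rho>. is_run A T \<rho> \<and> root_label \<rho> \<in> roots A}"

type_synonym amp = "int \<times> int \<times> int \<times> int \<times> int"

datatype tsym = X nat nat  \<comment> \<open>\<^term>\<open>X k j\<close> is the symbol with qubit index (subscript) k and tag (superscript) j\<close>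

definition tagged_ta :: "('q, tsym, amp) ta \<Rightarrow> bool" where
  "tagged_ta A \<longleftrightarrow>
     tree_automaton A \<and>
     (\<forall>q f q0 q1 p g p0 p1.
        IntTr q f q0 q1 \<in> transitions A \<and> IntTr p g p0 p1 \<in> transitions A \<and>
        IntTr q f q0 q1 \<noteq> (IntTr p g p0 p1 :: ('q, tsym, amp) transition) \<longrightarrow> f \<noteq> g)"

text \<open>\<open>tagged_subtree d m T\<close>: \<open>T\<close> is full of height \<open>m\<close>, and is correctly labelled when its root
  sits at depth \<open>d\<close> of the whole tree.\<close>

fun tagged_subtree :: "nat \<Rightarrow> nat \<Rightarrow> (tsym, amp) tree \<Rightarrow> bool" where
  "tagged_subtree d m (Leaf c) \<longleftrightarrow> m = 0"
| "tagged_subtree d m (Node (X k j) l r) \<longleftrightarrow>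
     m > 0 \<and> k = d + 1 \<and> tagged_subtree (d + 1) (m - 1) l \<and> tagged_subtree (d + 1) (m - 1) r"

definition tagged_qubit_tree :: "nat \<Rightarrow> (tsym, amp) tree \<Rightarrow> bool" where
  "tagged_qubit_tree n T \<longleftrightarrow> tagged_subtree 0 n T"

definition omega :: complex where
  "omega = exp (\<i> * of_real pi / 4)"

definition inv_sqrt2 :: complex where
  "inv_sqrt2 = 1 / of_real (sqrt 2)"

text \<open>Only the factors \<^const>\<open>omega\<close> and \<^const>\<open>inv_sqrt2\<close> are meaningful below.\<close>

fun mult_amp :: "complex \<Rightarrow> amp \<Rightarrow> amp" where
  "mult_amp v (a, b, c, d, k) =
     (if v = omega then (- d, a, b, c, k)
      else if v = inv_sqrt2 then (a, b, c, d, k + 1)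
      else undefined)"

fun amp_value :: "amp \<Rightarrow> complex" where
  "amp_value (a, b, c, d, k) =
     inv_sqrt2 powi k * (of_int a + of_int b * omega + of_int c * omega ^ 2 + of_int d * omega ^ 3)"

lemma omega_pow4: "omega ^ 4 = - 1"
proof -
  have "omega ^ 4 = exp (of_nat 4 * (\<i> * of_real pi / 4))"
    unfolding omega_def by (rule exp_of_nat_mult [symmetric])
  also have "\<dots> = exp (\<i> * of_real pi)" by simp
  finally show ?thesis by (simp add: exp_pi_i')
qed

lemma omega_neq_inv_sqrt2: "omega \<noteq> inv_sqrt2"
proof
  assume "omega = inv_sqrt2"
  moreover have "inv_sqrt2 ^ 2 = 1 / 2"
    by (simp add: inv_sqrt2_def power_divide flip: of_real_power)
  hence "(inv_sqrt2 ^ 2) ^ 2 = (1 / 2) ^ 2" by (rule arg_cong)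
  hence "inv_sqrt2 ^ 4 = 1 / 4" by (simp add: power_divide flip: power_mult)
  ultimately have "(1 / 4 :: complex) = - 1" using omega_pow4 by simp
  hence "Re (1 / 4) = Re (- 1)" by presburger
  thus False by simp
qed

lemma amp_value_mult_amp:
  assumes "v \<in> {omega, inv_sqrt2}"
  shows "amp_value (mult_amp v x) = v * amp_value x"
proof (cases x)
  case (fields a b c d k)
  have *: "omega * (omega * (omega * omega)) = - 1"
    using omega_pow4 by (simp add: power4_eq_xxxx mult.assoc)
  have **: "omega * (omega * (omega * (omega * y))) = - y" for y
    using arg_cong [OF *, of "\<lambda>z. z * y"] by (simp add: mult.assoc)
  have nz: "inv_sqrt2 \<noteq> 0" by (simp add: inv_sqrt2_def)
  show ?thesis
  proof (cases "v = omega")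
    case True
    show ?thesis
      by (simp add: True fields algebra_simps power2_eq_square power3_eq_cube * **)
  next
    case False
    hence "v = inv_sqrt2" using assms by simp
    thus ?thesis using omega_neq_inv_sqrt2 nz
      by (simp add: fields power_int_add mult_ac)
  qed
qed

declare mult_amp.simps [simp del]

definition scale_tree :: "complex \<Rightarrow> (tsym, amp) tree \<Rightarrow> (tsym, amp) tree" where
  "scale_tree v T = map_tree id (mult_amp v) T"

datatype square = Square

definition Tag :: "(tsym, amp) tree \<Rightarrow> (tsym, square) tree" where
  "Tag T = map_tree id (\<lambda>_. Square) T"

definition tag_equiv :: "('p, tsym, amp) ta \<Rightarrow> ('q, tsym, amp) ta \<Rightarrow> bool"
    (infix \<open>\<simeq>\<^sub>T\<^sub>a\<^sub>g\<close> 50) where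
  "B \<simeq>\<^sub>T\<^sub>a\<^sub>g A \<longleftrightarrow>
     (\<exists>S. bij_betw S (language A) (language B) \<and> (\<forall>T \<in> language A. Tag (S T) = Tag T))"

fun mult_transition ::
    "complex \<Rightarrow> ('q, tsym, amp) transition \<Rightarrow> ('q, tsym, amp) transition" where
  "mult_transition v (IntTr q f q0 q1) = IntTr q f q0 q1"
| "mult_transition v (LeafTr q c) = LeafTr q (mult_amp v c)"

text \<open>The constants of the alphabet are replaced along with the leaf transitions, so that the
  result is again a tree automaton over its alphabet.\<close>

definition Mult :: "('q, tsym, amp) ta \<Rightarrow> complex \<Rightarrow> ('q, tsym, amp) ta" where
  "Mult A v = A\<lparr>constants := mult_amp v ` constants A,
                transitions := mult_transition v ` transitions A\<rparr>"

lemma IntTr_in_Mult: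
  "IntTr q f q0 q1 \<in> transitions (Mult A v) \<longleftrightarrow> IntTr q f q0 q1 \<in> transitions A"
proof -
  have "IntTr q f q0 q1 = mult_transition v t \<longleftrightarrow> t = IntTr q f q0 q1" for t
    by (cases t) auto
  thus ?thesis by (simp add: Mult_def image_iff)
qed

lemma LeafTr_in_Mult:
  "LeafTr q c \<in> transitions (Mult A v) \<longleftrightarrow>
     (\<exists>c'. LeafTr q c' \<in> transitions A \<and> c = mult_amp v c')"
proof -
  have eq: "LeafTr q c = mult_transition v t \<longleftrightarrow> (\<exists>c'. t = LeafTr q c' \<and> c = mult_amp v c')" for t
    by (cases t) auto
  have "transitions (Mult A v) = mult_transition v ` transitions A"
    by (simp add: Mult_def)
  thus ?thesis by (simp only: image_iff eq) blast
qed

lemma tagged_ta_Mult: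
  assumes "tagged_ta A"
  shows "tagged_ta (Mult A v)"
proof -
  have TA: "tree_automaton A" using assms by (simp add: tagged_ta_def)
  have over: "transition_over (states A) (binaries A) (mult_amp v ` constants A) (mult_transition v t)"
    if "t \<in> transitions A" for t
    using TA that unfolding tree_automaton_def by (cases t) force+
  have "c = c'" if "LeafTr q c \<in> transitions (Mult A v)" "LeafTr q c' \<in> transitions (Mult A v)"
    for q c c'
    using TA that unfolding LeafTr_in_Mult tree_automaton_def by metis
  moreover have "finite (states (Mult A v))" "roots (Mult A v) \<subseteq> states (Mult A v)"
    using TA by (simp_all add: Mult_def tree_automaton_def)
  moreover have "\<forall>t \<in> transitions (Mult A v).
      transition_over (states (Mult A v)) (binaries (Mult A v)) (constants (Mult A v)) t"
    using over by (simp add: Mult_def)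
  ultimately have "tree_automaton (Mult A v)"
    unfolding tree_automaton_def by (intro conjI allI impI) auto
  thus ?thesis
    unfolding tagged_ta_def IntTr_in_Mult
    using assms [unfolded tagged_ta_def, THEN conjunct2] by (rule conjI)
qed

end

theory Submission
  imports Defs
begin

text \<open>\<^term>\<open>Mult A v\<close> and \<^term>\<open>A\<close> have the same runs up to scaling the leaves of the tree,
  and scaling is injective because multiplication by \<^term>\<open>v\<close> is injective on tuples; so scaling
  itself is the required tag-preserving bijection.\<close>

text \<open>On tuples, \<open>omega\<close> is a signed cyclic shift of the first four entries and
  \<open>inv_sqrt2\<close> a successor on the last; both can be undone. As the two constants differ,
  \<open>inv_sqrt2\<close> does reach the second branch of \<open>mult_amp\<close>.\<close>

lemma inj_mult_amp:
  assumes "v \<in> {omega, inv_sqrt2}"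
  shows "inj (mult_amp v)"
  using assms omega_neq_inv_sqrt2 by (auto simp: inj_def mult_amp.simps)

lemma inj_scale_tree:
  assumes "v \<in> {omega, inv_sqrt2}"
  shows "inj (scale_tree v)"
  using tree.inj_map [OF inj_on_id inj_mult_amp [OF assms]]
  by (simp add: inj_def scale_tree_def)

lemma Tag_scale_tree: "Tag (scale_tree v T) = Tag T"
  by (simp add: Tag_def scale_tree_def tree.map_comp comp_def id_def)

text \<open>The same \<rho> serves both sides, as only leaf labels change. The existential form
  yields the language as an image under \<open>scale_tree v\<close>.\<close>

lemma is_run_Mult_iff:
  "is_run (Mult A v) T \<rho> \<longleftrightarrow> (\<exists>T'. T = scale_tree v T' \<and> is_run A T' \<rho>)"
proof
  show "\<exists>T'. T = scale_tree v T' \<and> is_run A T' \<rho>" if "is_run (Mult A v) T \<rho>"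
    using that
  proof (induction "Mult A v" T \<rho> rule: is_run.induct)
    case (1 c q)
    then obtain c' where "LeafTr q c' \<in> transitions A" "c = mult_amp v c'"
      by (auto simp: LeafTr_in_Mult)
    \<comment> \<open>Each leaf transition of \<open>Mult A v\<close> stems from one of
      \<open>A\<close>, whose constant is the unscaled label.\<close>
    then show ?case
      by (intro exI [of _ "Leaf c'"]) (simp add: scale_tree_def)
  next
    case (2 f l r q \<rho>l \<rho>r)
    then obtain l' r' where "l = scale_tree v l'" "is_run A l' \<rho>l" "r = scale_tree v r'" "is_run A r' \<rho>r"
      by auto
    with 2 show ?case
      by (intro exI [of _ "Node f l' r'"]) (simp add: scale_tree_def IntTr_in_Mult)
  qed simp_all
next
  \<comment> \<open>At a leaf the witness is the old label as a whole;
    \<open>split_paired_Ex\<close> would break the quantified tuple into five integers and hide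
    it.\<close>
  have "is_run (Mult A v) (scale_tree v T') \<rho>" if "is_run A T' \<rho>" for T'
    using that
    by (induction A T' \<rho> rule: is_run.induct)
      (auto simp: scale_tree_def IntTr_in_Mult LeafTr_in_Mult simp del: split_paired_Ex)
  then show "is_run (Mult A v) T \<rho>" if "\<exists>T'. T = scale_tree v T' \<and> is_run A T' \<rho>"
    using that by blast
qed

lemma language_Mult: "language (Mult A v) = scale_tree v ` language A"
proof -
  have "roots (Mult A v) = roots A"
    by (simp add: Mult_def)
  then show ?thesis
    by (auto simp: language_def is_run_Mult_iff)
qed

theorem theorem6p7:
  fixes A :: "('q, tsym, amp) ta" and n :: nat and v :: complex
  assumes "tagged_ta A"
    and "\<forall>T \<in> language A. tagged_qubit_tree n T"
    and "v \<in> {omega, inv_sqrt2}"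
  shows "Mult A v \<simeq>\<^sub>T\<^sub>a\<^sub>g A \<and> language (Mult A v) = {scale_tree v T | T. T \<in> language A}"
proof
  have "bij_betw (scale_tree v) (language A) (language (Mult A v))"
    unfolding language_Mult
    by (rule inj_on_imp_bij_betw) (rule inj_on_subset [OF inj_scale_tree [OF assms(3)] subset_UNIV])
  then show "Mult A v \<simeq>\<^sub>T\<^sub>a\<^sub>g A"
    unfolding tag_equiv_def using Tag_scale_tree by blast
  show "language (Mult A v) = {scale_tree v T | T. T \<in> language A}"
    unfolding language_Mult by blast
qed

end
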